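(* Let $C\in\mathbb{R}^{m\times m\times m}$ be a tensor with trivial stabilizer under congruence by $\mathrm{GL}(m,\mathbb{R})$. Then the numerical non-identifiability of $C$ satisfies $$\kappa(C)\;\le\;\frac{\|C\|}{\max(\varsigma_m^{(1)},\varsigma_m^{(2)},\varsigma_m^{(3)})},$$ where $\varsigma_m^{(i)}$ denotes the smallest singular value of the $i$th flattening of $C$.
   Context: $\|\cdot\|$ denotes the Frobenius (Euclidean) norm of matrices and tensors. For $C=(c_{ijk})\in\mathbb{R}^{m\times m\times m}$ and $X=(x_{ij})\in\mathbb{R}^{d\times m}$, $[\![C;X,X,X]\!]\in\mathbb{R}^{d\times d\times d}$ has entries $[\![C;X,X,X]\!]_{\alpha\beta\gamma}=\sum_{i,j,k=1}^m c_{ijk}\,x_{\alpha i}x_{\beta j}x_{\gamma k}$. Trivial stabilizer (over $\mathbb{R}$) means that the only $Z\in\mathrm{GL}(m,\mathbb{R})$ with $[\![C;Z,Z,Z]\!]=C$ is $Z=I$. The set of ill-posed instances $\mathcal{N}(C,d)$ is the set of tensors $S\in\mathbb{R}^{d\times d\times d}$ for which $\{Y\in\mathbb{R}^{d\times m} : S=[\![C;Y,Y,Y]\!]\}$ has cardinality at least $2$. The numerical non-identifiability of a pair $(X,C)$ is $$\kappa(X,C)=\frac{\|X\|^3\cdot\|C\|}{\inf_{S\in\mathcal{N}(C,d)}\|[\![C;X,X,X]\!]-S\|}\in[0,\infty]$$ (with the usual conventions $\inf\emptyset=\infty$, $a/\infty=0$ and $a/0=\infty$ for $a>0$). The condition number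 of $X$ is $\kappa(X)=\|X\|\cdot\|X^+\|$, where $X^+$ is the pseudo-inverse. The numerical non-identifiability $\kappa(C)$ of $C$ is the smallest number satisfying $\kappa(C)\ge\kappa(X,C)/\kappa(X)^3$ for all $d$ and all $X\in\mathbb{R}^{d\times m}$ of rank $m$. The $i$th flattening $C^{(i)}$ of $C$ is the $m\times m^2$ matrix whose rows are labeled by the $i$th index of $C$ and whose columns are labeled by the pair of remaining indices. *)

theory Defs
  imports "Jordan_Normal_Form.DL_Rank" "HOL-Library.Extended_Nonnegative_Real"
begin

(* Cubic tensors of format n x n x n are functions on indices i, j, k < n, made extensional by the
   value 0 outside the index range, so that equality of tensors is equality of functions.
   All indices start at 0. *)

type_synonym tensor3 = "nat \<Rightarrow> nat \<Rightarrow> nat \<Rightarrow> real"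

definition carrier_tensor :: "nat \<Rightarrow> tensor3 set" where
  "carrier_tensor n = {T. \<forall>i j k. \<not> (i < n \<and> j < n \<and> k < n) \<longrightarrow> T i j k = 0}"

definition tensor_norm :: "nat \<Rightarrow> tensor3 \<Rightarrow> real" where
  "tensor_norm n T = sqrt (\<Sum>i<n. \<Sum>j<n. \<Sum>k<n. (T i j k)\<^sup>2)"

definition frob_norm :: "real mat \<Rightarrow> real" where
  "frob_norm A = sqrt (\<Sum>i<dim_row A. \<Sum>j<dim_col A. (A $$ (i, j))\<^sup>2)"

(* [[C; X, X, X]] for C of format m x m x m and X of format d x m, where m = dim_col X
   and d = dim_row X. *)
definition tensor_act :: "tensor3 \<Rightarrow> real mat \<Rightarrow> tensor3" where
  "tensor_act C X = (\<lambda>a b c.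
     if a < dim_row X \<and> b < dim_row X \<and> c < dim_row X
     then \<Sum>i<dim_col X. \<Sum>j<dim_col X. \<Sum>k<dim_col X.
            C i j k * X $$ (a, i) * X $$ (b, j) * X $$ (c, k)
     else 0)"

definition trivial_stabilizer :: "nat \<Rightarrow> tensor3 \<Rightarrow> bool" where
  "trivial_stabilizer m C \<longleftrightarrow>
     (\<forall>Z \<in> carrier_mat m m. invertible_mat Z \<longrightarrow> tensor_act C Z = C \<longrightarrow> Z = 1\<^sub>m m)"

definition decompositions :: "nat \<Rightarrow> tensor3 \<Rightarrow> nat \<Rightarrow> tensor3 \<Rightarrow> real mat set" where
  "decompositions m C d S = {Y \<in> carrier_mat d m. S = tensor_act C Y}"

(* The disjunct "infinite" is needed because card is 0 on infinite sets. *)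
definition ill_posed :: "nat \<Rightarrow> tensor3 \<Rightarrow> nat \<Rightarrow> tensor3 set" where
  "ill_posed m C d = {S \<in> carrier_tensor d.
     infinite (decompositions m C d S) \<or> 2 \<le> card (decompositions m C d S)}"

(* The conventions inf {} = \<infinity>, a / \<infinity> = 0 and a / 0 = \<infinity> for a > 0
   are those of ennreal. *)
definition non_identifiability_pair :: "real mat \<Rightarrow> tensor3 \<Rightarrow> ennreal" where
  "non_identifiability_pair X C =
     ennreal (frob_norm X ^ 3 * tensor_norm (dim_col X) C) /
     (INF S \<in> ill_posed (dim_col X) C (dim_row X).
        ennreal (tensor_norm (dim_row X) (\<lambda>a b c. tensor_act C X a b c - S a b c)))"

(* Moore-Penrose pseudo-inverse, characterized by the four Penrose equations. *)
definition pseudo_inverse :: "real mat \<Rightarrow> real mat" where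
  "pseudo_inverse A = (THE B. B \<in> carrier_mat (dim_col A) (dim_row A) \<and>
     A * B * A = A \<and> B * A * B = B \<and>
     transpose_mat (A * B) = A * B \<and> transpose_mat (B * A) = B * A)"

definition cond_number :: "real mat \<Rightarrow> real" where
  "cond_number X = frob_norm X * frob_norm (pseudo_inverse X)"

definition non_identifiability :: "nat \<Rightarrow> tensor3 \<Rightarrow> ennreal" where
  "non_identifiability m C = (LEAST K. \<forall>d. \<forall>X \<in> carrier_mat d m.
     vec_space.rank d X = m \<longrightarrow>
     non_identifiability_pair X C / ennreal (cond_number X ^ 3) \<le> K)"

(* The column labeled by the pair (p, q) of remaining indices, in their original order,
   has number p * m + q. *)
definition flattening1 :: "nat \<Rightarrow> tensor3 \<Rightarrow> real mat" where
  "flattening1 m C = mat m (m * m) (\<lambda>(i, r). C i (r div m) (r mod m))"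

definition flattening2 :: "nat \<Rightarrow> tensor3 \<Rightarrow> real mat" where
  "flattening2 m C = mat m (m * m) (\<lambda>(j, r). C (r div m) j (r mod m))"

definition flattening3 :: "nat \<Rightarrow> tensor3 \<Rightarrow> real mat" where
  "flattening3 m C = mat m (m * m) (\<lambda>(k, r). C (r div m) (r mod m) k)"

(* s is a singular value iff it has unit left and right singular vectors u and v. For a p x q
   matrix this gives exactly the values occurring among the min p q diagonal entries of an SVD;
   in particular 0 counts iff the rank is less than min p q. *)
definition singular_value :: "real mat \<Rightarrow> real \<Rightarrow> bool" where
  "singular_value A s \<longleftrightarrow> 0 \<le> s \<and>
     (\<exists>u \<in> carrier_vec (dim_row A). \<exists>v \<in> carrier_vec (dim_col A).
        u \<bullet> u = 1 \<and> v \<bullet> v = 1 \<and>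
        A *\<^sub>v v = s \<cdot>\<^sub>v u \<and> transpose_mat A *\<^sub>v u = s \<cdot>\<^sub>v v)"

definition smallest_singular_value :: "real mat \<Rightarrow> real" where
  "smallest_singular_value A = (LEAST s. singular_value A s)"

end

theory Submission
  imports Defs "HOL-Analysis.Function_Topology" "HOL-Analysis.L2_Norm"
begin

text \<open>
  Let \<open>B\<close> be the pseudo-inverse of \<open>X\<close>, so that \<open>B X = 1\<close>, and let \<open>S = [[C; Y, Y, Y]]\<close> be ill-posed.
  If \<open>B Y\<close> were invertible, \<open>Y\<close> would have a left inverse. For any left inverse \<open>V\<close> of \<open>Y\<close> and any other
  decomposition \<open>Y'\<close> of \<open>S\<close>, the matrix \<open>V Y'\<close> stabilizes \<open>C\<close>, so \<open>V Y' = 1\<close>; as \<open>V\<close> is arbitrary this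
  forces \<open>Y' = Y\<close>. So \<open>Z = B Y\<close> is singular. Contracting \<open>C - [[C; Z, Z, Z]]\<close> in one mode with a unit vector
  in the left kernel of \<open>Z\<close> removes the second term, so the norm of this tensor is at least the smallest
  singular value of the corresponding flattening. On the other hand it is the image of
  \<open>[[C; X, X, X]] - S\<close> under \<open>B\<close>, so its norm is at most |[[C; X, X, X]] - S| times |B|^3.
\<close>

section \<open>Norms of tensors and matrices, and the action \<open>tensor_act\<close>\<close>

lemma Cauchy_Schwarz_sum:
  fixes a b :: "'a \<Rightarrow> real"
  shows "(\<Sum>i\<in>I. a i * b i)\<^sup>2 \<le> (\<Sum>i\<in>I. (a i)\<^sup>2) * (\<Sum>i\<in>I. (b i)\<^sup>2)"
proof -
  have "\<bar>\<Sum>i\<in>I. a i * b i\<bar> \<le> (\<Sum>i\<in>I. \<bar>a i\<bar> * \<bar>b i\<bar>)"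
    by (rule order_trans[OF sum_abs]) (simp add: abs_mult)
  also have "\<dots> \<le> L2_set a I * L2_set b I"
    by (rule L2_set_mult_ineq)
  finally have "(\<Sum>i\<in>I. a i * b i)\<^sup>2 \<le> (L2_set a I * L2_set b I)\<^sup>2"
    by (rule power2_le_iff_abs_le[THEN iffD2, rotated]) (simp add: L2_set_nonneg)
  then show ?thesis
    by (simp add: power_mult_distrib L2_set_def sum_nonneg)
qed

lemma sum_triple:
  "(\<Sum>i\<in>A. \<Sum>j\<in>B. \<Sum>k\<in>D. f i j k) = (\<Sum>(i, j, k)\<in>A \<times> B \<times> D. f i j k)"
  by (simp add: sum.cartesian_product)

lemma sum_triple_product:
  fixes f g h :: "'a \<Rightarrow> 'b :: comm_semiring_0"
  shows "(\<Sum>(i, j, k)\<in>A \<times> B \<times> D. f i * g j * h k) = sum f A * sum g B * sum h D"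
proof -
  have "sum f A * sum g B * sum h D = (\<Sum>i\<in>A. \<Sum>j\<in>B. f i * g j * sum h D)"
    by (subst sum_product) (simp only: sum_distrib_right)
  then show ?thesis
    by (simp only: sum_distrib_left sum_triple[symmetric])
qed

lemma tensor_norm_nonneg: "0 \<le> tensor_norm n T"
  by (simp add: tensor_norm_def sum_nonneg)

lemma tensor_norm_square: "(tensor_norm n T)\<^sup>2 = (\<Sum>i<n. \<Sum>j<n. \<Sum>k<n. (T i j k)\<^sup>2)"
  by (simp add: tensor_norm_def sum_nonneg)

lemma frob_norm_nonneg: "0 \<le> frob_norm A"
  by (simp add: frob_norm_def sum_nonneg)

lemma frob_norm_square: "(frob_norm A)\<^sup>2 = (\<Sum>i<dim_row A. \<Sum>j<dim_col A. (A $$ (i, j))\<^sup>2)"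
  by (simp add: frob_norm_def sum_nonneg)

lemma frob_norm_pos:
  assumes "i < dim_row A" "j < dim_col A" "A $$ (i, j) \<noteq> 0"
  shows "0 < frob_norm A"
proof -
  have "0 < (\<Sum>j<dim_col A. (A $$ (i, j))\<^sup>2)"
    using assms by - (rule sum_pos2[of _ j], auto intro!: sum_nonneg)
  then have "0 < (\<Sum>i<dim_row A. \<Sum>j<dim_col A. (A $$ (i, j))\<^sup>2)"
    using assms by - (rule sum_pos2[of _ i], auto intro!: sum_nonneg)
  then show ?thesis
    by (simp add: frob_norm_def)
qed

lemma tensor_norm_pos:
  assumes "i < n" "j < n" "k < n" "T i j k \<noteq> 0"
  shows "0 < tensor_norm n T"
proof -
  have "0 < (\<Sum>k<n. (T i j k)\<^sup>2)"
    using assms by - (rule sum_pos2[of _ k], auto intro!: sum_nonneg)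
  then have "0 < (\<Sum>j<n. \<Sum>k<n. (T i j k)\<^sup>2)"
    using assms by - (rule sum_pos2[of _ j], auto intro!: sum_nonneg)
  then have "0 < (\<Sum>i<n. \<Sum>j<n. \<Sum>k<n. (T i j k)\<^sup>2)"
    using assms by - (rule sum_pos2[of _ i], auto intro!: sum_nonneg)
  then show ?thesis
    by (simp add: tensor_norm_def)
qed

lemma tensor_act_diff:
  "tensor_act (\<lambda>i j k. S i j k - T i j k) W = (\<lambda>a b c. tensor_act S W a b c - tensor_act T W a b c)"
  by (intro ext) (simp add: tensor_act_def sum_subtractf left_diff_distrib)

lemma tensor_act_one:
  assumes "C \<in> carrier_tensor m"
  shows "tensor_act C (1\<^sub>m m) = C"
proof (intro ext)
  fix a b c
  show "tensor_act C (1\<^sub>m m) a b c = C a b c"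
  proof (cases "a < m \<and> b < m \<and> c < m")
    case True
    have "tensor_act C (1\<^sub>m m) a b c =
        (\<Sum>i<m. \<Sum>j<m. \<Sum>k<m. if k = c then if j = b then if i = a then C i j k else 0 else 0 else 0)"
      unfolding tensor_act_def using True by (simp only: index_one_mat if_True simp_thms) (intro sum.cong refl, use True in auto)
    also have "\<dots> = C a b c"
      using True by simp
    finally show ?thesis .
  next
    case False
    then show ?thesis
      using assms by (auto simp: tensor_act_def carrier_tensor_def)
  qed
qed

text \<open>After exchanging the two triple sums, the inner one factors into three entries of the
  product \<open>W * X\<close>. This is what transports statements between formats \<open>d\<close>
  and \<open>m\<close>.\<close>

lemma tensor_act_tensor_act:
  assumes X: "X \<in> carrier_mat d m" and W: "W \<in> carrier_mat p d"
  shows "tensor_act (tensor_act C X) W = tensor_act C (W * X)"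
proof (intro ext)
  fix a b c
  let ?D = "{..<d} \<times> {..<d} \<times> {..<d}" and ?M = "{..<m} \<times> {..<m} \<times> {..<m}"
  show "tensor_act (tensor_act C X) W a b c = tensor_act C (W * X) a b c"
  proof (cases "a < p \<and> b < p \<and> c < p")
    case True
    have "tensor_act (tensor_act C X) W a b c = (\<Sum>(i, j, k)\<in>?D. (\<Sum>(x, y, z)\<in>?M.
        C x y z * X $$ (i, x) * X $$ (j, y) * X $$ (k, z)) * W $$ (a, i) * W $$ (b, j) * W $$ (c, k))"
      using True X W by (auto simp: tensor_act_def sum_triple intro!: sum.cong)
    also have "\<dots> = (\<Sum>(i, j, k)\<in>?D. \<Sum>(x, y, z)\<in>?M. C x y z *
        ((W $$ (a, i) * X $$ (i, x)) * (W $$ (b, j) * X $$ (j, y)) * (W $$ (c, k) * X $$ (k, z))))"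
      by (simp only: case_prod_unfold sum_distrib_right) (simp only: mult_ac)
    also have "\<dots> = (\<Sum>(x, y, z)\<in>?M. C x y z * (\<Sum>(i, j, k)\<in>?D.
        (W $$ (a, i) * X $$ (i, x)) * (W $$ (b, j) * X $$ (j, y)) * (W $$ (c, k) * X $$ (k, z))))"
      by (simp add: case_prod_unfold sum_distrib_left) (rule sum.swap)
    also have "\<dots> = (\<Sum>(x, y, z)\<in>?M. C x y z * ((\<Sum>i<d. W $$ (a, i) * X $$ (i, x)) *
        (\<Sum>j<d. W $$ (b, j) * X $$ (j, y)) * (\<Sum>k<d. W $$ (c, k) * X $$ (k, z))))"
      by (simp only: sum_triple_product)
    also have "\<dots> = (\<Sum>(x, y, z)\<in>?M. C x y z * (W * X) $$ (a, x) * (W * X) $$ (b, y) * (W * X) $$ (c, z))"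
      using True X W by (auto simp: scalar_prod_def atLeast0LessThan mult.assoc intro!: sum.cong)
    also have "\<dots> = tensor_act C (W * X) a b c"
      using True X W by (auto simp: tensor_act_def sum_triple intro!: sum.cong)
    finally show ?thesis .
  next
    case False
    \<comment> \<open>Outside the format of \<open>W\<close> both sides take the default value
      0.\<close>
    then show ?thesis
      using W by (auto simp: tensor_act_def)
  qed
qed

text \<open>Each entry is the inner product of \<open>T\<close> with a rank-one tensor built from
  three rows of \<open>W\<close>. By Cauchy-Schwarz its square is at most |T|^2 times the product of
  three squared row norms, and summing over all triples of rows gives |W|^6.\<close>

lemma tensor_norm_tensor_act_le:
  assumes W: "W \<in> carrier_mat p d"
  shows "tensor_norm p (tensor_act T W) \<le> tensor_norm d T * frob_norm W ^ 3"
proof (rule power2_le_imp_le)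
  let ?D = "{..<d} \<times> {..<d} \<times> {..<d}"
  let ?r = "\<lambda>a. \<Sum>i<d. (W $$ (a, i))\<^sup>2"
  have entry: "(tensor_act T W a b c)\<^sup>2 \<le> (tensor_norm d T)\<^sup>2 * (?r a * ?r b * ?r c)"
    if "a < p" "b < p" "c < p" for a b c
  proof -
    let ?t = "\<lambda>s. case s of (i, j, k) \<Rightarrow> T i j k"
    let ?w = "\<lambda>s. case s of (i, j, k) \<Rightarrow> W $$ (a, i) * W $$ (b, j) * W $$ (c, k)"
    have act: "tensor_act T W a b c = (\<Sum>s\<in>?D. ?t s * ?w s)"
      using that W by (auto simp: tensor_act_def sum_triple mult.assoc intro!: sum.cong)
    have t: "(\<Sum>s\<in>?D. (?t s)\<^sup>2) = (tensor_norm d T)\<^sup>2"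
      by (simp only: tensor_norm_square sum_triple case_prod_unfold)
    have "(\<Sum>s\<in>?D. (?w s)\<^sup>2) =
        (\<Sum>(i, j, k)\<in>?D. (W $$ (a, i))\<^sup>2 * (W $$ (b, j))\<^sup>2 * (W $$ (c, k))\<^sup>2)"
      by (simp only: case_prod_unfold power_mult_distrib)
    also have "\<dots> = ?r a * ?r b * ?r c"
      by (rule sum_triple_product)
    finally have w: "(\<Sum>s\<in>?D. (?w s)\<^sup>2) = ?r a * ?r b * ?r c" .
    show ?thesis
      using Cauchy_Schwarz_sum[of ?t ?w ?D] unfolding act t w .
  qed
  have "(tensor_norm p (tensor_act T W))\<^sup>2 \<le>
      (\<Sum>a<p. \<Sum>b<p. \<Sum>c<p. (tensor_norm d T)\<^sup>2 * (?r a * ?r b * ?r c))"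
    by (subst tensor_norm_square) (intro sum_mono entry; simp)
  also have "\<dots> = (tensor_norm d T)\<^sup>2 * (\<Sum>(a, b, c)\<in>{..<p} \<times> {..<p} \<times> {..<p}. ?r a * ?r b * ?r c)"
    by (simp only: sum_triple[symmetric] sum_distrib_left)
  also have "\<dots> = (tensor_norm d T)\<^sup>2 * ((frob_norm W)\<^sup>2 * (frob_norm W)\<^sup>2 * (frob_norm W)\<^sup>2)"
    using W by (simp only: sum_triple_product frob_norm_square) auto
  also have "\<dots> = (tensor_norm d T * frob_norm W ^ 3)\<^sup>2"
    by (simp add: power2_eq_square power3_eq_cube mult_ac)
  finally show "(tensor_norm p (tensor_act T W))\<^sup>2 \<le> (tensor_norm d T * frob_norm W ^ 3)\<^sup>2" .
  show "0 \<le> tensor_norm d T * frob_norm W ^ 3"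
    by (simp add: tensor_norm_nonneg frob_norm_nonneg)
qed

text \<open>The mode permutations here and in the next three lemmas reduce the second and third
  flattening to the first.\<close>

lemma tensor_norm_swap12: "tensor_norm n (\<lambda>i j k. T j i k) = tensor_norm n T"
  unfolding tensor_norm_def by (subst sum.swap) simp

lemma tensor_norm_rotate: "tensor_norm n (\<lambda>i j k. T j k i) = tensor_norm n T"
proof -
  have "(\<Sum>i<n. \<Sum>j<n. \<Sum>k<n. (T j k i)\<^sup>2) = (\<Sum>j<n. \<Sum>i<n. \<Sum>k<n. (T j k i)\<^sup>2)"
    by (rule sum.swap)
  also have "\<dots> = (\<Sum>j<n. \<Sum>k<n. \<Sum>i<n. (T j k i)\<^sup>2)"
    by (intro sum.cong refl sum.swap)
  finally show ?thesis
    by (simp add: tensor_norm_def)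
qed

lemma tensor_act_swap12: "tensor_act (\<lambda>i j k. C j i k) Z = (\<lambda>a b c. tensor_act C Z b a c)"
proof (intro ext)
  fix a b c
  have "(\<Sum>i<dim_col Z. \<Sum>j<dim_col Z. \<Sum>k<dim_col Z. C j i k * Z $$ (a, i) * Z $$ (b, j) * Z $$ (c, k)) =
      (\<Sum>j<dim_col Z. \<Sum>i<dim_col Z. \<Sum>k<dim_col Z. C j i k * Z $$ (b, j) * Z $$ (a, i) * Z $$ (c, k))"
    by (subst sum.swap) (simp add: mult_ac)
  then show "tensor_act (\<lambda>i j k. C j i k) Z a b c = tensor_act C Z b a c"
    by (auto simp: tensor_act_def)
qed

lemma tensor_act_rotate: "tensor_act (\<lambda>i j k. C j k i) Z = (\<lambda>a b c. tensor_act C Z b c a)"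
proof (intro ext)
  fix a b c
  let ?N = "{..<dim_col Z}"
  let ?f = "\<lambda>i j k. C j k i * Z $$ (b, j) * Z $$ (c, k) * Z $$ (a, i)"
  have "(\<Sum>i\<in>?N. \<Sum>j\<in>?N. \<Sum>k\<in>?N. C j k i * Z $$ (a, i) * Z $$ (b, j) * Z $$ (c, k)) =
      (\<Sum>i\<in>?N. \<Sum>j\<in>?N. \<Sum>k\<in>?N. ?f i j k)"
    by (simp add: mult_ac)
  also have "\<dots> = (\<Sum>j\<in>?N. \<Sum>i\<in>?N. \<Sum>k\<in>?N. ?f i j k)"
    by (rule sum.swap)
  also have "\<dots> = (\<Sum>j\<in>?N. \<Sum>k\<in>?N. \<Sum>i\<in>?N. ?f i j k)"
    by (intro sum.cong refl sum.swap)
  finally show "tensor_act (\<lambda>i j k. C j k i) Z a b c = tensor_act C Z b c a"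
    by (auto simp: tensor_act_def)
qed

section \<open>Real matrices\<close>

lemma scalar_prod_self_sum: "v \<in> carrier_vec n \<Longrightarrow> v \<bullet> v = (\<Sum>i<n. (v $ i :: real)\<^sup>2)"
  by (simp add: scalar_prod_def power2_eq_square atLeast0LessThan)

lemma scalar_prod_self_nonneg: "0 \<le> v \<bullet> (v :: real vec)"
  by (simp add: scalar_prod_def sum_nonneg)

lemma scalar_prod_self_eq_0_iff:
  "v \<in> carrier_vec n \<Longrightarrow> v \<bullet> v = 0 \<longleftrightarrow> v = (0\<^sub>v n :: real vec)"
  by (auto simp: scalar_prod_self_sum sum_nonneg_eq_0_iff intro!: eq_vecI)

lemma normalize_vec:
  fixes w :: "real vec"
  assumes w: "w \<in> carrier_vec n" and nz: "w \<noteq> 0\<^sub>v n"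
  obtains c v where "c > 0" "c\<^sup>2 = w \<bullet> w" "v = (1 / c) \<cdot>\<^sub>v w" "w = c \<cdot>\<^sub>v v" "v \<in> carrier_vec n" "v \<bullet> v = 1"
proof -
  have pos: "w \<bullet> w > 0"
    using scalar_prod_self_nonneg[of w] scalar_prod_self_eq_0_iff[OF w] nz by linarith
  define c where "c = sqrt (w \<bullet> w)"
  have c: "c > 0" "c\<^sup>2 = w \<bullet> w"
    using pos by (auto simp: c_def)
  have unit: "((1 / c) \<cdot>\<^sub>v w) \<bullet> ((1 / c) \<cdot>\<^sub>v w) = 1"
    using c w pos by (simp add: power2_eq_square[symmetric])
  show ?thesis
    by (rule that[OF c refl _ _ unit]) (use c w in \<open>auto simp: smult_smult_assoc\<close>)
qed

lemma invertible_mat_of_det: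
  fixes Z :: "real mat"
  assumes Z: "Z \<in> carrier_mat n n" and "det Z \<noteq> 0"
  obtains Zi where "Zi \<in> carrier_mat n n" "Zi * Z = 1\<^sub>m n" "Z * Zi = 1\<^sub>m n" "invertible_mat Z"
proof -
  \<comment> \<open>\<open>undefined\<close> only fills the last parameter of
    \<open>ring_mat\<close>, which does not affect its units.\<close>
  from det_non_zero_imp_unit[OF assms, of undefined]
  obtain Zi where Zi: "Zi \<in> carrier_mat n n" "Zi * Z = 1\<^sub>m n" "Z * Zi = 1\<^sub>m n"
    by (auto simp: Units_def ring_mat_def)
  then have "invertible_mat Z"
    using Z by (auto simp: invertible_mat_def inverts_mat_def square_mat.simps)
  with Zi show ?thesis by (rule that)
qed

text \<open>Independence speaks of the set of columns, so repeated columns must be excluded first: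
  they would leave fewer than \<open>m\<close> distinct columns and hence rank below
  \<open>m\<close>. A nonzero kernel vector would then be a linear dependence of independent
  columns.\<close>

lemma full_column_rank_inj:
  fixes X :: "real mat"
  assumes X: "X \<in> carrier_mat d m" and rank: "vec_space.rank d X = m"
    and v: "v \<in> carrier_vec m" "X *\<^sub>v v = 0\<^sub>v d"
  shows "v = 0\<^sub>v m"
proof -
  interpret vec_space "TYPE(real)" d .
  have dist: "distinct (cols X)"
  proof (rule ccontr)
    assume "\<not> distinct (cols X)"
    then have less: "card (set (cols X)) < m"
      using X card_length[of "cols X"] card_distinct[of "cols X"] by fastforce
    obtain S where S: "maximal S (\<lambda>T. T \<subseteq> set (cols X) \<and> lin_indpt T)"
      using maximal_exists[of "\<lambda>T. T \<subseteq> set (cols X) \<and> lin_indpt T" "card (set (cols X))" "{}"]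
      by (meson List.finite_set card_mono empty_iff empty_subsetI finite_lin_indpt2 rev_finite_subset)
    then have "rank X \<le> card (set (cols X))"
      using rank_card_indpt[OF X S] by (simp add: card_mono maximal_def)
    with less assms(2) show False by simp
  qed
  show ?thesis
    using lin_depI[OF X v(1) _ v(2) dist] full_rank_lin_indpt[OF X rank dist] by blast
qed

text \<open>For the uniqueness required by \<open>THE\<close>: any other solution \<open>B'\<close>
  is also a left inverse of \<open>X\<close>, and \<open>X * B\<close> and \<open>X * B'\<close> are
  both the orthogonal projection onto the column space of \<open>X\<close>, hence equal.\<close>

lemma pseudo_inverse_eqI:
  assumes X: "X \<in> carrier_mat d m" and B: "B \<in> carrier_mat m d"
    and BX: "B * X = 1\<^sub>m m" and sym: "transpose_mat (X * B) = X * B"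
  shows "pseudo_inverse X = B"
  unfolding pseudo_inverse_def
proof (rule the_equality)
  show "B \<in> carrier_mat (dim_col X) (dim_row X) \<and> X * B * X = X \<and> B * X * B = B \<and>
      transpose_mat (X * B) = X * B \<and> transpose_mat (B * X) = B * X"
    using assms by (auto simp: assoc_mult_mat[OF X B X])
next
  fix B' assume "B' \<in> carrier_mat (dim_col X) (dim_row X) \<and> X * B' * X = X \<and> B' * X * B' = B' \<and>
      transpose_mat (X * B') = X * B' \<and> transpose_mat (B' * X) = B' * X"
  then have B': "B' \<in> carrier_mat m d" and XBX: "X * B' * X = X" and BXB: "B' * X * B' = B'"
    and sym': "transpose_mat (X * B') = X * B'"
    using X by auto
  have "B' * X = B * X * (B' * X)"
    using B' X by (simp add: BX)
  also have "\<dots> = B * (X * B' * X)"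
    using B B' X by (simp add: assoc_mult_mat[of _ m d _ m _ m] assoc_mult_mat[of _ d m _ d _ m])
  finally have B'X: "B' * X = 1\<^sub>m m"
    by (simp add: XBX BX)
  \<comment> \<open>Here \<open>X * B = (X * B') * (X * B)\<close>; transposing reverses the two
    symmetric factors, and the new product collapses to \<open>X * B'\<close>.\<close>
  have "(X * B') * (X * B) = X * B' * X * B"
    by (rule assoc_mult_mat[symmetric]) (use X B B' in auto)
  then have "transpose_mat (X * B) = transpose_mat ((X * B') * (X * B))"
    by (simp add: XBX)
  also have "\<dots> = transpose_mat (X * B) * transpose_mat (X * B')"
    by (rule transpose_mult) (use X B B' in auto)
  finally have "X * B = (X * B) * (X * B')"
    by (simp only: sym sym')
  also have "\<dots> = X * (B * (X * B'))"
    by (rule assoc_mult_mat[OF X B]) (use X B' in auto)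
  also have "B * (X * B') = B * X * B'"
    by (rule assoc_mult_mat[OF B X B', symmetric])
  finally have XB: "X * B = X * B'"
    using B' by (simp add: BX)
  have "B' = B' * X * B'" by (simp add: BXB)
  also have "\<dots> = B' * (X * B)"
    using X B' by (simp add: XB)
  also have "\<dots> = B' * X * B"
    using X B' B by simp
  finally show "B' = B"
    using B by (simp add: B'X)
qed

text \<open>The pseudo-inverse is (X^T X)^-1 X^T. The Gram matrix is nonsingular because v^T X^T X v
  = |X v|^2 and \<open>X\<close> is injective.\<close>

lemma pseudo_inverse_full_column_rank:
  assumes X: "X \<in> carrier_mat d m" and rank: "vec_space.rank d X = m"
  shows "pseudo_inverse X \<in> carrier_mat m d" "pseudo_inverse X * X = 1\<^sub>m m"
proof -
  let ?G = "transpose_mat X * X"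
  have G: "?G \<in> carrier_mat m m" and XT: "transpose_mat X \<in> carrier_mat m d"
    using X by auto
  have "det ?G \<noteq> 0"
  proof
    assume "det ?G = 0"
    then obtain v where v: "v \<in> carrier_vec m" "v \<noteq> 0\<^sub>v m" "?G *\<^sub>v v = 0\<^sub>v m"
      using det_0_iff_vec_prod_zero[OF G] by blast
    have Xv: "X *\<^sub>v v \<in> carrier_vec d"
      using X v by simp
    have "(X *\<^sub>v v) \<bullet> (X *\<^sub>v v) = (transpose_mat X *\<^sub>v (X *\<^sub>v v)) \<bullet> v"
      using transpose_vec_mult_scalar[OF X v(1) Xv] by simp
    also have "\<dots> = 0"
      using v X by simp
    finally have "X *\<^sub>v v = 0\<^sub>v d"
      using scalar_prod_self_eq_0_iff[OF Xv] by simp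
    then show False
      using full_column_rank_inj[OF X rank] v by blast
  qed
  then obtain Gi where Gi: "Gi \<in> carrier_mat m m" "Gi * ?G = 1\<^sub>m m" "?G * Gi = 1\<^sub>m m"
    using invertible_mat_of_det[OF G] by blast
  have "transpose_mat ?G = ?G"
    using X by (simp add: transpose_mult[OF XT X])
  then have GiT: "transpose_mat Gi * ?G = 1\<^sub>m m"
    using arg_cong[OF Gi(3), of transpose_mat] transpose_mult[OF G Gi(1)] by simp
  \<comment> \<open>A left inverse of the Gram matrix equals its right inverse, so \<open>Gi\<close>
    is symmetric; this makes \<open>X * ?B\<close> symmetric.\<close>
  have "transpose_mat Gi = transpose_mat Gi * (?G * Gi)"
    using Gi by simp
  also have "\<dots> = transpose_mat Gi * ?G * Gi"
    using G Gi(1) by (intro assoc_mult_mat[symmetric]) auto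
  finally have Gi_sym: "transpose_mat Gi = Gi"
    using Gi(1) GiT by simp
  let ?B = "Gi * transpose_mat X"
  have B: "?B \<in> carrier_mat m d"
    using Gi XT by simp
  have BX: "?B * X = 1\<^sub>m m"
    using Gi X XT by (simp add: assoc_mult_mat[OF Gi(1) XT X])
  have "transpose_mat (X * ?B) = transpose_mat ?B * transpose_mat X"
    using X B by (rule transpose_mult)
  also have "transpose_mat ?B = X * Gi"
    using transpose_mult[OF Gi(1) XT] by (simp add: Gi_sym)
  also have "X * Gi * transpose_mat X = X * ?B"
    using X Gi(1) XT by simp
  finally have "pseudo_inverse X = ?B"
    using pseudo_inverse_eqI[OF X B BX] by simp
  then show "pseudo_inverse X \<in> carrier_mat m d" "pseudo_inverse X * X = 1\<^sub>m m"
    using B BX by simp_all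
qed

text \<open>The minimum exists by compactness, with vectors represented as points of the product
  space of functions on \<open>nat\<close>. Homogeneity extends the inequality from unit vectors to
  all \<open>w\<close>.\<close>

lemma unit_sphere_min:
  fixes M :: "real mat"
  assumes M: "M \<in> carrier_mat k n" and n: "1 \<le> n"
  obtains u where "u \<in> carrier_vec n" "u \<bullet> u = 1"
    "\<And>w. w \<in> carrier_vec n \<Longrightarrow> (M *\<^sub>v u) \<bullet> (M *\<^sub>v u) * (w \<bullet> w) \<le> (M *\<^sub>v w) \<bullet> (M *\<^sub>v w)"
proof -
  define f :: "(nat \<Rightarrow> real) \<Rightarrow> real" where "f x = (\<Sum>r<k. (\<Sum>i<n. M $$ (r, i) * x i)\<^sup>2)" for x
  \<comment> \<open>The box makes Tychonoff's theorem applicable. It does not restrict the first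
    \<open>n\<close> coordinates, since the sphere already bounds them by 1, and the remaining ones
    do not enter \<open>f\<close>.\<close>
  define S :: "(nat \<Rightarrow> real) set" where "S = {x. (\<Sum>i<n. (x i)\<^sup>2) = 1} \<inter> (\<Pi>\<^sub>E i\<in>UNIV. {-1..1})"
  have cont: "continuous_on A (\<lambda>x. x i)" for A and i :: nat
    by (rule continuous_on_subset[OF continuous_on_product_coordinates]) simp
  have "compactin (product_topology (\<lambda>i::nat. euclidean) UNIV) (\<Pi>\<^sub>E i\<in>UNIV. {-1..1::real})"
    unfolding compactin_PiE by simp
  then have "compact (\<Pi>\<^sub>E i\<in>(UNIV :: nat set). {-1..1::real})"
    by (simp add: euclidean_product_topology)
  moreover have "closed {x :: nat \<Rightarrow> real. (\<Sum>i<n. (x i)\<^sup>2) = 1}"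
    by (intro closed_Collect_eq continuous_intros cont)
  ultimately have "compact S"
    unfolding S_def by (rule closed_Int_compact[rotated])
  moreover have "(\<lambda>i. if i = 0 then 1 else 0) \<in> S"
    using n by (auto simp: S_def if_distrib[of "\<lambda>x. x\<^sup>2"] cong: if_cong)
  moreover have "continuous_on S f"
    unfolding f_def by (intro continuous_intros cont)
  ultimately obtain x where x: "x \<in> S" and xmin: "\<And>y. y \<in> S \<Longrightarrow> f x \<le> f y"
    using continuous_attains_inf[of S f] by blast
  have f_vec: "(M *\<^sub>v w) \<bullet> (M *\<^sub>v w) = f y" if "w \<in> carrier_vec n" "\<And>i. i < n \<Longrightarrow> y i = w $ i" for w y
    using M that by (simp add: scalar_prod_def f_def power2_eq_square atLeast0LessThan)
  show ?thesis
  proof (rule that[of "vec n x"])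
    show "vec n x \<bullet> vec n x = 1"
      using x by (simp add: scalar_prod_self_sum[of _ n] S_def)
  next
    fix w :: "real vec" assume w: "w \<in> carrier_vec n"
    show "(M *\<^sub>v vec n x) \<bullet> (M *\<^sub>v vec n x) * (w \<bullet> w) \<le> (M *\<^sub>v w) \<bullet> (M *\<^sub>v w)"
    proof (cases "w = 0\<^sub>v n")
      case True
      then show ?thesis by (simp add: scalar_prod_self_nonneg)
    next
      case False
      then obtain c v where c: "c > 0" "c\<^sup>2 = w \<bullet> w" "w = c \<cdot>\<^sub>v v" and v: "v \<in> carrier_vec n" "v \<bullet> v = 1"
        using normalize_vec[OF w] by metis
      define y where "y i = (if i < n then v $ i else 0)" for i
      have sum_v: "(\<Sum>i<n. (v $ i)\<^sup>2) = 1"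
        using v scalar_prod_self_sum[of v n] by simp
      have "\<bar>v $ i\<bar> \<le> 1" if "i < n" for i
        using member_le_sum[of i "{..<n}" "\<lambda>i. (v $ i)\<^sup>2"] that sum_v by (simp add: abs_square_le_1)
      then have "y \<in> S"
        using sum_v by (auto simp: S_def y_def abs_le_iff minus_le_iff)
      then have "f x \<le> f y"
        by (rule xmin)
      moreover have "(M *\<^sub>v w) \<bullet> (M *\<^sub>v w) = c\<^sup>2 * f y"
      proof -
        have "M *\<^sub>v w = c \<cdot>\<^sub>v (M *\<^sub>v v)"
          using mult_mat_vec[OF M v(1)] c by simp
        then show ?thesis
          using f_vec[OF v(1), of y] M by (simp add: y_def power2_eq_square)
      qed
      moreover have "(M *\<^sub>v vec n x) \<bullet> (M *\<^sub>v vec n x) = f x"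
        by (rule f_vec) auto
      ultimately show ?thesis
        unfolding c(2)[symmetric] by (simp add: mult.commute[of _ "c\<^sup>2"] mult_left_mono)
    qed
  qed simp
qed

section \<open>Singular values of flattenings\<close>

text \<open>The first-order condition at a minimum, without derivatives: a small step against the
  sign of \<open>G\<close> would make the expression negative.\<close>

lemma nonneg_quadratic_linear_coeff:
  fixes G Q :: real
  assumes "\<And>t. 0 \<le> 2 * t * G + t\<^sup>2 * Q"
  shows "G = 0"
proof (rule ccontr)
  assume "G \<noteq> 0"
  \<comment> \<open>At t = -e G the expression is e G^2 (e Q - 2), and this \<open>e\<close> ensures
    e Q \<le> 1.\<close>
  define e where "e = 1 / (\<bar>Q\<bar> + 1)"
  have e: "e > 0" "e * Q \<le> 1"
    by (auto simp: e_def divide_simps)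
  have "0 \<le> e * G\<^sup>2 * (e * Q - 2)"
    using assms[of "- (e * G)"] by (simp add: algebra_simps power2_eq_square)
  moreover have "e * G\<^sup>2 * (e * Q - 2) < 0"
    using e \<open>G \<noteq> 0\<close> by (intro mult_pos_neg) auto
  ultimately show False by simp
qed

lemma scalar_prod_self_add_smult:
  fixes a b :: "real vec"
  assumes "a \<in> carrier_vec n" "b \<in> carrier_vec n"
  shows "(a + t \<cdot>\<^sub>v b) \<bullet> (a + t \<cdot>\<^sub>v b) = a \<bullet> a + 2 * t * (a \<bullet> b) + t\<^sup>2 * (b \<bullet> b)"
  using assms
  by (simp add: scalar_prod_add_distrib[of _ n] add_scalar_prod_distrib[of _ n]
      comm_scalar_prod[of b n a] power2_eq_square algebra_simps)

text \<open>Let \<open>u\<close> minimize |A^T w| on the unit sphere. The minimum value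
  \<open>s\<close> is itself a singular value with left vector \<open>u\<close>, and no singular
  value is smaller, so the \<open>LEAST\<close> is attained at \<open>s\<close>.\<close>

lemma smallest_singular_value_bound:
  assumes A: "A \<in> carrier_mat n k" and n: "1 \<le> n" "n \<le> k"
  shows "0 \<le> smallest_singular_value A"
    and "w \<in> carrier_vec n \<Longrightarrow>
      (smallest_singular_value A)\<^sup>2 * (w \<bullet> w) \<le> (transpose_mat A *\<^sub>v w) \<bullet> (transpose_mat A *\<^sub>v w)"
proof -
  let ?M = "transpose_mat A"
  have M: "?M \<in> carrier_mat k n"
    using A by simp
  obtain u where u: "u \<in> carrier_vec n" "u \<bullet> u = 1" and
    umin: "\<And>w. w \<in> carrier_vec n \<Longrightarrow> (?M *\<^sub>v u) \<bullet> (?M *\<^sub>v u) * (w \<bullet> w) \<le> (?M *\<^sub>v w) \<bullet> (?M *\<^sub>v w)"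
    using unit_sphere_min[OF M n(1)] by blast
  define \<mu> where "\<mu> = (?M *\<^sub>v u) \<bullet> (?M *\<^sub>v u)"
  define s where "s = sqrt \<mu>"
  have \<mu>: "0 \<le> \<mu>" and s: "0 \<le> s" "s\<^sup>2 = \<mu>"
    by (auto simp: \<mu>_def s_def scalar_prod_self_nonneg)
  have Mu: "?M *\<^sub>v u \<in> carrier_vec k"
    using M u by simp
  define g where "g = A *\<^sub>v (?M *\<^sub>v u) - \<mu> \<cdot>\<^sub>v u"
  have g: "g \<in> carrier_vec n"
    using A u by (simp add: g_def)
  have Mg: "?M *\<^sub>v g \<in> carrier_vec k"
    using M g by simp
  \<comment> \<open>\<open>g\<close> is half the gradient at \<open>u\<close> of the quadratic form |A^T w|^2 - \<mu> |w|^2, which is minimal at \<open>u\<close>.\<close>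
  have "g \<bullet> g = (?M *\<^sub>v u) \<bullet> (?M *\<^sub>v g) - \<mu> * (u \<bullet> g)"
  proof -
    have "g \<bullet> g = g \<bullet> (A *\<^sub>v (?M *\<^sub>v u)) - g \<bullet> (\<mu> \<cdot>\<^sub>v u)"
      using A u g Mu by (subst (2) g_def) (simp add: scalar_prod_minus_distrib[of _ n])
    also have "g \<bullet> (A *\<^sub>v (?M *\<^sub>v u)) = (?M *\<^sub>v u) \<bullet> (?M *\<^sub>v g)"
      using transpose_vec_mult_scalar[OF A Mu g] comm_scalar_prod[OF Mg Mu] by simp
    also have "g \<bullet> (\<mu> \<cdot>\<^sub>v u) = \<mu> * (u \<bullet> g)"
      using u g comm_scalar_prod[of u n g] by simp
    finally show ?thesis .
  qed
  moreover have "(?M *\<^sub>v u) \<bullet> (?M *\<^sub>v g) - \<mu> * (u \<bullet> g) = 0"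
  proof (rule nonneg_quadratic_linear_coeff)
    \<comment> \<open>This is \<open>umin\<close> at u + t g, expanded in \<open>t\<close>; the
      constant term is \<mu> - \<mu> = 0 because |u| = 1.\<close>
    fix t
    have "?M *\<^sub>v (u + t \<cdot>\<^sub>v g) = ?M *\<^sub>v u + t \<cdot>\<^sub>v (?M *\<^sub>v g)"
      using M u g by (simp add: mult_add_distrib_mat_vec[OF M] mult_mat_vec[OF M])
    then show "0 \<le> 2 * t * ((?M *\<^sub>v u) \<bullet> (?M *\<^sub>v g) - \<mu> * (u \<bullet> g)) +
        t\<^sup>2 * ((?M *\<^sub>v g) \<bullet> (?M *\<^sub>v g) - \<mu> * (g \<bullet> g))"
      using umin[of "u + t \<cdot>\<^sub>v g"] u g
      by (simp add: scalar_prod_self_add_smult[OF u(1) g] scalar_prod_self_add_smult[OF Mu Mg]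
          \<mu>_def[symmetric] algebra_simps)
  qed
  ultimately have "g = 0\<^sub>v n"
    using scalar_prod_self_eq_0_iff[OF g] by simp
  have AMu: "A *\<^sub>v (?M *\<^sub>v u) = \<mu> \<cdot>\<^sub>v u"
  proof (rule eq_vecI)
    fix i assume i: "i < dim_vec (\<mu> \<cdot>\<^sub>v u)"
    have "g $ i = 0"
      using \<open>g = 0\<^sub>v n\<close> i u by simp
    then show "(A *\<^sub>v (?M *\<^sub>v u)) $ i = (\<mu> \<cdot>\<^sub>v u) $ i"
      using i by (simp only: g_def index_minus_vec)
  qed (use A u in simp)
  have "singular_value A s"
  \<comment> \<open>For nonzero \<open>s\<close> the right singular vector is A^T u / s. For s = 0
    that vector vanishes, and a unit vector in the kernel of \<open>A\<close> has to be found
    separately.\<close>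
  proof (cases "s = 0")
    case False
    define v where "v = (1 / s) \<cdot>\<^sub>v (?M *\<^sub>v u)"
    have v: "v \<in> carrier_vec k"
      using Mu by (simp add: v_def)
    have "\<mu> \<noteq> 0"
      using False s by auto
    then have "v \<bullet> v = 1"
      using Mu s by (simp add: v_def \<mu>_def[symmetric] power2_eq_square[symmetric])
    moreover have "A *\<^sub>v v = s \<cdot>\<^sub>v u"
      using False by (simp add: v_def mult_mat_vec[OF A Mu] AMu smult_smult_assoc s(2)[symmetric] power2_eq_square)
    moreover have "?M *\<^sub>v u = s \<cdot>\<^sub>v v"
      using False by (simp add: v_def smult_smult_assoc)
    ultimately show ?thesis
      using s u v A unfolding singular_value_def by auto
  next
    case True
    then have Mu0: "?M *\<^sub>v u = 0\<^sub>v k"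
      using s scalar_prod_self_eq_0_iff[OF Mu] by (simp add: \<mu>_def)
    \<comment> \<open>A right kernel vector: the leading square block of \<open>A\<close> (recall \<open>n \<le> k\<close>) is singular.\<close>
    define B where "B = mat n n (\<lambda>(i, j). A $$ (i, j))"
    have B: "B \<in> carrier_mat n n"
      by (simp add: B_def)
    have "transpose_mat B *\<^sub>v u = 0\<^sub>v n"
    proof (rule eq_vecI)
      fix j assume "j < dim_vec (0\<^sub>v n :: real vec)"
      then have j: "j < n" by simp
      then have "(transpose_mat B *\<^sub>v u) $ j = (?M *\<^sub>v u) $ j"
        using A B n u by (simp add: scalar_prod_def B_def)
      then show "(transpose_mat B *\<^sub>v u) $ j = 0\<^sub>v n $ j"
        using j n by (simp add: Mu0)
    qed (use B in simp)
    moreover have "u \<noteq> 0\<^sub>v n"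
      using u by auto
    ultimately have "det (transpose_mat B) = 0"
      using det_0_iff_vec_prod_zero[of "transpose_mat B" n] B u by auto
    then have "det B = 0"
      using det_transpose[OF B] by simp
    then obtain w where w: "w \<in> carrier_vec n" "w \<noteq> 0\<^sub>v n" "B *\<^sub>v w = 0\<^sub>v n"
      using det_0_iff_vec_prod_zero[OF B] by blast
    obtain c v where c: "c > 0" "w = c \<cdot>\<^sub>v v" "v = (1 / c) \<cdot>\<^sub>v w" and v: "v \<in> carrier_vec n" "v \<bullet> v = 1"
      using normalize_vec[OF w(1,2)] by metis
    have Bv: "B *\<^sub>v v = 0\<^sub>v n"
      using c(3) w(3) by (simp add: mult_mat_vec[OF B w(1)]) (intro eq_vecI; simp)
    \<comment> \<open>Padding with zeros turns a kernel vector of the block \<open>B\<close> into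
      one of \<open>A\<close> without changing its norm.\<close>
    define v' where "v' = vec k (\<lambda>j. if j < n then v $ j else 0)"
    have restrict: "(\<Sum>j<k. f j * (if j < n then h j else 0)) = (\<Sum>j<n. f j * h j)" for f h :: "nat \<Rightarrow> real"
      using n by (intro sum.mono_neutral_cong_right) auto
    have zero: "A *\<^sub>v v' = 0\<^sub>v n"
    proof (rule eq_vecI)
      fix i assume "i < dim_vec (0\<^sub>v n :: real vec)"
      then have i: "i < n" by simp
      then have "(A *\<^sub>v v') $ i = (\<Sum>j<n. A $$ (i, j) * v $ j)"
        using A by (simp add: scalar_prod_def v'_def atLeast0LessThan restrict)
      also have "\<dots> = (B *\<^sub>v v) $ i"
        using i v B by (simp add: scalar_prod_def B_def atLeast0LessThan)
      finally show "(A *\<^sub>v v') $ i = 0\<^sub>v n $ i"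
        using i by (simp add: Bv)
    qed (use A in simp)
    have "A *\<^sub>v v' = s \<cdot>\<^sub>v u"
      unfolding zero using True u by (intro eq_vecI; simp)
    moreover have "?M *\<^sub>v u = s \<cdot>\<^sub>v v'"
      unfolding Mu0 using True by (intro eq_vecI; simp add: v'_def)
    moreover have "v' \<bullet> v' = 1"
    proof -
      have "v' \<bullet> v' = (\<Sum>j<k. (if j < n then v $ j else 0) * (if j < n then v $ j else 0))"
        by (simp add: scalar_prod_def v'_def atLeast0LessThan)
      also have "\<dots> = (\<Sum>j<n. v $ j * v $ j)"
        by (subst restrict) (rule sum.cong; simp)
      also have "\<dots> = 1"
        using v by (simp add: scalar_prod_def atLeast0LessThan)
      finally show ?thesis .
    qed
    moreover have "v' \<in> carrier_vec k"
      by (simp add: v'_def)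
    ultimately show ?thesis
      using s u A unfolding singular_value_def by auto
  qed
  moreover have "s \<le> s'" if sv: "singular_value A s'" for s'
  proof -
    obtain u' v' where *: "0 \<le> s'" "u' \<in> carrier_vec n" "v' \<in> carrier_vec k" "u' \<bullet> u' = 1" "v' \<bullet> v' = 1"
      "?M *\<^sub>v u' = s' \<cdot>\<^sub>v v'"
      using sv A unfolding singular_value_def by auto
    \<comment> \<open>The left vector \<open>u'\<close> is a unit vector with |A^T u'| = s', so it
      competes in the minimum.\<close>
    then have "s\<^sup>2 \<le> s'\<^sup>2"
      using umin[of u'] s by (simp add: \<mu>_def[symmetric] power2_eq_square)
    then show ?thesis
      using *(1) by (rule power2_le_imp_le)
  qed
  ultimately have eq: "smallest_singular_value A = s"
    unfolding smallest_singular_value_def by (rule Least_equality)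
  show "0 \<le> smallest_singular_value A"
    by (simp add: eq s)
  show "(smallest_singular_value A)\<^sup>2 * (w \<bullet> w) \<le> (?M *\<^sub>v w) \<bullet> (?M *\<^sub>v w)" if "w \<in> carrier_vec n"
    using umin[OF that] by (simp add: eq s \<mu>_def)
qed

text \<open>Undoes the numbering of the columns of a flattening by pairs of indices.\<close>

lemma sum_div_mod:
  "(\<Sum>r<m * m. f (r div m) (r mod m)) = (\<Sum>j<m. \<Sum>k<(m::nat). f j k)"
proof -
  have "j * m + k < m * m" if "j < m" "k < m" for j k
  proof -
    have "j * m + k < Suc j * m"
      using that by simp
    also have "\<dots> \<le> m * m"
      using that by (intro mult_le_mono1) simp
    finally show ?thesis .
  qed
  then have "(\<Sum>r<m * m. f (r div m) (r mod m)) = (\<Sum>(j, k)\<in>{..<m} \<times> {..<m}. f j k)"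
    by (intro sum.reindex_bij_witness[of _ "\<lambda>(j, k). j * m + k" "\<lambda>r. (r div m, r mod m)"])
       (auto simp: less_mult_imp_div_less intro!: mod_less_divisor Nat.gr0I)
  then show ?thesis
    by (simp add: sum.cartesian_product)
qed

lemma singular_value_flattening1_le:
  assumes m: "1 \<le> m" and Z: "Z \<in> carrier_mat m m" and det: "det Z = 0"
  shows "smallest_singular_value (flattening1 m C) \<le>
    tensor_norm m (\<lambda>i j k. C i j k - tensor_act C Z i j k)"
proof (rule power2_le_imp_le)
  let ?D = "\<lambda>i j k. C i j k - tensor_act C Z i j k" and ?F = "flattening1 m C"
  let ?M = "{..<m} \<times> {..<m} \<times> {..<m}"
  have F: "?F \<in> carrier_mat m (m * m)"
    by (simp add: flattening1_def)
  have "det (transpose_mat Z) = 0"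
    using det det_transpose[OF Z] by simp
  then obtain u where u: "u \<in> carrier_vec m" "u \<noteq> 0\<^sub>v m" "transpose_mat Z *\<^sub>v u = 0\<^sub>v m"
    using det_0_iff_vec_prod_zero[of "transpose_mat Z" m] Z by auto
  obtain c v where c: "v = (1 / c) \<cdot>\<^sub>v u" and v: "v \<in> carrier_vec m" "v \<bullet> v = 1"
    using normalize_vec[OF u(1,2)] by metis
  have Zv: "transpose_mat Z *\<^sub>v v = 0\<^sub>v m"
    using c u Z by (simp add: mult_mat_vec[of _ m m]) (intro eq_vecI; simp)
  have Zv_entry: "(\<Sum>a<m. Z $$ (a, i) * v $ a) = 0" if "i < m" for i
    using arg_cong[OF Zv, of "\<lambda>w. w $ i"] that Z v by (simp add: scalar_prod_def atLeast0LessThan)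
  \<comment> \<open>Contracting the first mode of [[C; Z, Z, Z]] with \<open>v\<close> brings out
    the factor Z^T v = 0.\<close>
  have vanish: "(\<Sum>a<m. v $ a * tensor_act C Z a b c) = 0" if "b < m" "c < m" for b c
  proof -
    have "(\<Sum>a<m. v $ a * tensor_act C Z a b c) =
        (\<Sum>a<m. \<Sum>(i, j, k)\<in>?M. C i j k * Z $$ (b, j) * Z $$ (c, k) * (Z $$ (a, i) * v $ a))"
      using that Z
      by (auto simp: tensor_act_def sum_triple sum_distrib_left case_prod_unfold mult_ac intro!: sum.cong)
    also have "\<dots> = (\<Sum>(i, j, k)\<in>?M. C i j k * Z $$ (b, j) * Z $$ (c, k) * (\<Sum>a<m. Z $$ (a, i) * v $ a))"
      by (simp only: case_prod_unfold sum_distrib_left) (rule sum.swap)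
    also have "\<dots> = 0"
      by (rule sum.neutral) (auto simp: Zv_entry)
    finally show ?thesis .
  qed
  have sum_v: "(\<Sum>a<m. (v $ a)\<^sup>2) = 1"
    using v scalar_prod_self_sum[of v m] by simp
  have "(smallest_singular_value ?F)\<^sup>2 \<le> (transpose_mat ?F *\<^sub>v v) \<bullet> (transpose_mat ?F *\<^sub>v v)"
    using smallest_singular_value_bound(2)[OF F m _ v(1)] m v by simp
  also have "\<dots> = (\<Sum>r<m * m. (\<Sum>a<m. v $ a * C a (r div m) (r mod m))\<^sup>2)"
    using v by (simp add: scalar_prod_def flattening1_def atLeast0LessThan power2_eq_square mult.commute)
  also have "\<dots> = (\<Sum>j<m. \<Sum>k<m. (\<Sum>a<m. v $ a * C a j k)\<^sup>2)"
    by (rule sum_div_mod)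
  \<comment> \<open>By \<open>vanish\<close>, \<open>C\<close> and the difference \<open>?D\<close>
    have the same contraction with \<open>v\<close>; Cauchy-Schwarz with |v| = 1 then bounds it by
    the norm of \<open>?D\<close>.\<close>
  also have "\<dots> = (\<Sum>j<m. \<Sum>k<m. (\<Sum>a<m. v $ a * ?D a j k)\<^sup>2)"
    by (intro sum.cong refl) (simp add: right_diff_distrib sum_subtractf vanish)
  also have "\<dots> \<le> (\<Sum>j<m. \<Sum>k<m. \<Sum>a<m. (?D a j k)\<^sup>2)"
  proof (intro sum_mono)
    fix j k
    show "(\<Sum>a<m. v $ a * ?D a j k)\<^sup>2 \<le> (\<Sum>a<m. (?D a j k)\<^sup>2)"
      using Cauchy_Schwarz_sum[of "\<lambda>a. v $ a" "\<lambda>a. ?D a j k" "{..<m}"] by (simp add: sum_v)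
  qed
  also have "\<dots> = (tensor_norm m (\<lambda>j k a. ?D a j k))\<^sup>2"
    by (simp only: tensor_norm_square)
  also have "tensor_norm m (\<lambda>j k a. ?D a j k) = tensor_norm m ?D"
    by (rule tensor_norm_rotate[symmetric])
  finally show "(smallest_singular_value ?F)\<^sup>2 \<le> (tensor_norm m ?D)\<^sup>2" .
qed (rule tensor_norm_nonneg)

lemma singular_value_flattening2_le:
  assumes "1 \<le> m" "Z \<in> carrier_mat m m" "det Z = 0"
  shows "smallest_singular_value (flattening2 m C) \<le>
    tensor_norm m (\<lambda>i j k. C i j k - tensor_act C Z i j k)"
proof -
  have "flattening2 m C = flattening1 m (\<lambda>i j k. C j i k)"
    by (simp add: flattening1_def flattening2_def)
  then show ?thesis
    using singular_value_flattening1_le[OF assms, of "\<lambda>i j k. C j i k"]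
      tensor_norm_swap12[of m "\<lambda>i j k. C i j k - tensor_act C Z i j k"]
    by (simp only: tensor_act_swap12[of C])
qed

lemma singular_value_flattening3_le:
  assumes "1 \<le> m" "Z \<in> carrier_mat m m" "det Z = 0"
  shows "smallest_singular_value (flattening3 m C) \<le>
    tensor_norm m (\<lambda>i j k. C i j k - tensor_act C Z i j k)"
proof -
  have "flattening3 m C = flattening1 m (\<lambda>i j k. C j k i)"
    by (simp add: flattening1_def flattening3_def)
  then show ?thesis
    using singular_value_flattening1_le[OF assms, of "\<lambda>i j k. C j k i"]
      tensor_norm_rotate[of m "\<lambda>i j k. C i j k - tensor_act C Z i j k"]
    by (simp only: tensor_act_rotate[of C])
qed

section \<open>Distance to the ill-posed instances\<close>

text \<open>The zero tensor is stabilized by twice the identity, which differs from the identity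
  because m \<ge> 1.\<close>

lemma trivial_stabilizer_nonzero:
  assumes m: "1 \<le> m" and C: "C \<in> carrier_tensor m" and triv: "trivial_stabilizer m C"
  shows "0 < tensor_norm m C"
proof -
  have "\<exists>i j k. C i j k \<noteq> 0"
  proof (rule ccontr)
    assume "\<nexists>i j k. C i j k \<noteq> 0"
    then have zero: "C = (\<lambda>i j k. 0)"
      by (intro ext) simp
    let ?Z = "2 \<cdot>\<^sub>m 1\<^sub>m m :: real mat"
    have Z: "?Z \<in> carrier_mat m m" by simp
    have "det ?Z \<noteq> 0"
      by (simp add: det_smult)
    then have "invertible_mat ?Z"
      using invertible_mat_of_det[OF Z] by blast
    moreover have "tensor_act C ?Z = C"
      by (intro ext) (simp add: zero tensor_act_def)
    ultimately have "?Z = 1\<^sub>m m"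
      using triv Z unfolding trivial_stabilizer_def by blast
    then have "?Z $$ (0, 0) = 1\<^sub>m m $$ (0, 0)"
      by simp
    then show False
      using m by simp
  qed
  then obtain i j k where nz: "C i j k \<noteq> 0"
    by blast
  then have "i < m \<and> j < m \<and> k < m"
    using C unfolding carrier_tensor_def by blast
  then show ?thesis
    using nz by (auto intro: tensor_norm_pos)
qed

text \<open>If \<open>W\<close> is a left inverse of \<open>Y\<close>, then so is \<open>W + N (1 - Y W)\<close> for every \<open>N\<close>; hence
  \<open>(1 - Y W) Y' = 0\<close>.\<close>
lemma eq_if_all_left_inverses:
  fixes Y Y' :: "real mat"
  assumes m: "1 \<le> m" and Y: "Y \<in> carrier_mat d m" and Y': "Y' \<in> carrier_mat d m"
    and W: "W \<in> carrier_mat m d" "W * Y = 1\<^sub>m m"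
    and all: "\<And>V. V \<in> carrier_mat m d \<Longrightarrow> V * Y = 1\<^sub>m m \<Longrightarrow> V * Y' = 1\<^sub>m m"
  shows "Y' = Y"
proof -
  define P where "P = 1\<^sub>m d - Y * W"
  have P: "P \<in> carrier_mat d d"
    using Y W by (simp add: P_def minus_carrier_mat)
  have YW: "Y * W \<in> carrier_mat d d"
    using Y W by simp
  have Pm: "P * X = X - Y * (W * X)" if X: "X \<in> carrier_mat d m" for X
    using that Y W YW by (simp add: P_def minus_mult_distrib_mat[OF _ YW X] assoc_mult_mat[OF Y W(1) X])
  have PY: "P * Y = 0\<^sub>m d m"
    using Y W by (simp add: Pm)
  have "(P * Y') $$ (i, j) = 0" if ij: "i < d" "j < m" for i j
  proof -
    \<comment> \<open>With this \<open>N\<close>, every row of \<open>N * M\<close> is row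
      \<open>i\<close> of \<open>M\<close>, so reading off row 0 below isolates row \<open>i\<close>
      of \<open>P * Y'\<close>.\<close>
    define N :: "real mat" where "N = mat m d (\<lambda>(p, q). if q = i then 1 else 0)"
    have N: "N \<in> carrier_mat m d" by (simp add: N_def)
    have NP: "N * P \<in> carrier_mat m d" using N P by simp
    \<comment> \<open>Adding \<open>N * P\<close> keeps a left inverse of \<open>Y\<close>, because
      P Y = 0.\<close>
    have "(W + N * P) * Y = W * Y + N * (P * Y)"
      using add_mult_distrib_mat[OF W(1) NP Y] assoc_mult_mat[OF N P Y] by simp
    also have "\<dots> = 1\<^sub>m m"
      using N W Y by (simp add: PY)
    finally have "(W + N * P) * Y' = 1\<^sub>m m"
      using all W NP by simp
    then have "1\<^sub>m m + N * (P * Y') = 1\<^sub>m m"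
      using add_mult_distrib_mat[OF W(1) NP Y'] assoc_mult_mat[OF N P Y'] all[OF W] by simp
    from arg_cong[OF this, of "\<lambda>M. M $$ (0, j)"] have "(N * (P * Y')) $$ (0, j) = 0"
      using m ij N P Y' by simp
    moreover have "(N * (P * Y')) $$ (0, j) = (\<Sum>q<d. (if q = i then 1 else 0) * (P * Y') $$ (q, j))"
      using m ij N P Y' by (simp add: N_def scalar_prod_def atLeast0LessThan del: index_mult_mat(1))
        (simp add: scalar_prod_def atLeast0LessThan)
    ultimately show ?thesis
      using ij by (simp add: if_distrib[of "\<lambda>x. x * _"] cong: if_cong)
  qed
  \<comment> \<open>P Y' = Y' - Y (W Y'), and W Y' = 1 by \<open>all\<close>.\<close>
  then have zero: "Y' - Y = 0\<^sub>m d m"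
    using Y Y' all[OF W] Pm[OF Y'] P by (intro eq_matI) auto
  show ?thesis
  proof (rule eq_matI)
    fix i j assume ij: "i < dim_row Y" "j < dim_col Y"
    have "(Y' - Y) $$ (i, j) = 0"
      unfolding zero using ij Y by simp
    then show "Y' $$ (i, j) = Y $$ (i, j)"
      using ij by simp
  qed (use Y Y' in auto)
qed

text \<open>Each left inverse \<open>V\<close> of \<open>Y\<close> carries the common tensor back to
  \<open>C\<close>, so \<open>V * Y'\<close> fixes \<open>C\<close>. The assumption
  \<open>concise\<close> makes this matrix invertible, as \<open>trivial_stabilizer\<close> speaks
  of invertible matrices only.\<close>

lemma decomposition_unique:
  assumes m: "1 \<le> m" and C: "C \<in> carrier_tensor m" and triv: "trivial_stabilizer m C"
    and concise: "\<And>Z. Z \<in> carrier_mat m m \<Longrightarrow> tensor_act C Z = C \<Longrightarrow> det Z \<noteq> 0"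
    and Y: "Y \<in> carrier_mat d m" and Y': "Y' \<in> carrier_mat d m"
    and W: "W \<in> carrier_mat m d" "W * Y = 1\<^sub>m m"
    and eq: "tensor_act C Y' = tensor_act C Y"
  shows "Y' = Y"
proof (rule eq_if_all_left_inverses[OF m Y Y' W])
  fix V :: "real mat" assume V: "V \<in> carrier_mat m d" "V * Y = 1\<^sub>m m"
  have Z: "V * Y' \<in> carrier_mat m m"
    using V Y' by simp
  have "tensor_act C (V * Y') = tensor_act (tensor_act C Y') V"
    by (rule tensor_act_tensor_act[OF Y' V(1), symmetric])
  also have "\<dots> = C"
    using tensor_act_tensor_act[OF Y V(1), of C] V(2) tensor_act_one[OF C] by (simp add: eq)
  finally have stab: "tensor_act C (V * Y') = C" .
  then have "invertible_mat (V * Y')"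
    using invertible_mat_of_det[OF Z concise[OF Z]] by blast
  then show "V * Y' = 1\<^sub>m m"
    using triv Z stab unfolding trivial_stabilizer_def by blast
qed

text \<open>The flattenings enter only through \<open>gap\<close>, so the maximum of the three
  singular values can be inserted for \<sigma> at once.\<close>

lemma ill_posed_distance:
  assumes m: "1 \<le> m" and C: "C \<in> carrier_tensor m" and triv: "trivial_stabilizer m C"
    and \<sigma>: "0 < \<sigma>"
    and gap: "\<And>Z. Z \<in> carrier_mat m m \<Longrightarrow> det Z = 0 \<Longrightarrow>
      \<sigma> \<le> tensor_norm m (\<lambda>i j k. C i j k - tensor_act C Z i j k)"
    and X: "X \<in> carrier_mat d m" and B: "B \<in> carrier_mat m d" and BX: "B * X = 1\<^sub>m m"
    and S: "S \<in> ill_posed m C d"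
  shows "\<sigma> \<le> tensor_norm d (\<lambda>a b c. tensor_act C X a b c - S a b c) * frob_norm B ^ 3"
proof -
  obtain Y Y' where Y: "Y \<in> carrier_mat d m" "S = tensor_act C Y"
    and Y': "Y' \<in> carrier_mat d m" "S = tensor_act C Y'" and neq: "Y' \<noteq> Y"
  proof -
    let ?E = "decompositions m C d S"
    \<comment> \<open>Both disjuncts of \<open>ill_posed\<close>, infinite and at least two, exclude
      cardinalities 0 and 1.\<close>
    have "\<not> is_singleton ?E" "?E \<noteq> {}"
      using S by (auto simp: ill_posed_def is_singleton_altdef)
    then obtain Y Y' where "Y \<in> ?E" "Y' \<in> ?E" "Y' \<noteq> Y"
      by (metis is_singletonI')
    then show ?thesis
      using that by (auto simp: decompositions_def)
  qed
  \<comment> \<open>A singular \<open>Z\<close> fixing \<open>C\<close> would give the difference in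
    \<open>gap\<close> norm 0, against \<sigma> > 0.\<close>
  have concise: "det Z \<noteq> 0" if Z: "Z \<in> carrier_mat m m" "tensor_act C Z = C" for Z
    using gap[OF Z(1)] \<sigma> Z(2) by (auto simp: tensor_norm_def)
  have Z: "B * Y \<in> carrier_mat m m"
    using B Y by simp
  have "det (B * Y) = 0"
  proof (rule ccontr)
    assume "det (B * Y) \<noteq> 0"
    then obtain Zi where Zi: "Zi \<in> carrier_mat m m" "Zi * (B * Y) = 1\<^sub>m m"
      using invertible_mat_of_det[OF Z] by blast
    have "Zi * B * Y = 1\<^sub>m m"
      using assoc_mult_mat[OF Zi(1) B Y(1)] Zi(2) by simp
    then have "Y' = Y"
      using decomposition_unique[OF m C triv concise Y(1) Y'(1), of "Zi * B"] Zi(1) B Y(2) Y'(2) by simp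
    with neq show False by simp
  qed
  then have "\<sigma> \<le> tensor_norm m (\<lambda>i j k. C i j k - tensor_act C (B * Y) i j k)"
    by (rule gap[OF Z])
  \<comment> \<open>Since B X = 1, acting with \<open>B\<close> sends [[C; X, X, X]] to
    \<open>C\<close> and \<open>S\<close> to [[C; B Y, B Y, B Y]]; the action is linear in the
    tensor.\<close>
  also have "(\<lambda>i j k. C i j k - tensor_act C (B * Y) i j k) =
      tensor_act (\<lambda>a b c. tensor_act C X a b c - S a b c) B"
    using tensor_act_tensor_act[OF X B, of C] tensor_act_tensor_act[OF Y(1) B, of C] tensor_act_one[OF C]
    by (simp add: tensor_act_diff Y(2) BX)
  also have "tensor_norm m \<dots> \<le> tensor_norm d (\<lambda>a b c. tensor_act C X a b c - S a b c) * frob_norm B ^ 3"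
    by (rule tensor_norm_tensor_act_le[OF B])
  finally show ?thesis .
qed

section \<open>From the distance bound to the non-identifiability of \<open>C\<close>\<close>

lemma non_identifiability_le:
  assumes "\<And>d X. X \<in> carrier_mat d m \<Longrightarrow> vec_space.rank d X = m \<Longrightarrow>
    non_identifiability_pair X C / ennreal (cond_number X ^ 3) \<le> K"
  shows "non_identifiability m C \<le> K"
proof -
  let ?S = "{non_identifiability_pair X C / ennreal (cond_number X ^ 3) | d X.
    X \<in> carrier_mat d m \<and> vec_space.rank d X = m}"
  \<comment> \<open>The least upper bound exists because \<open>ennreal\<close> is a complete
    lattice.\<close>
  have "non_identifiability m C = Sup ?S"
    unfolding non_identifiability_def by (rule Least_equality) (auto intro!: Sup_upper Sup_least)
  also have "\<dots> \<le> K"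
    using assms by (auto intro!: Sup_least)
  finally show ?thesis .
qed

lemma frob_norm_pos_of_left_inverse:
  assumes m: "1 \<le> m" and X: "X \<in> carrier_mat d m" and B: "B \<in> carrier_mat m d" and BX: "B * X = 1\<^sub>m m"
  shows "0 < frob_norm X" "0 < frob_norm B"
proof -
  have "(\<Sum>q<d. B $$ (0, q) * X $$ (q, 0)) = 1"
    using arg_cong[OF BX, of "\<lambda>M. M $$ (0, 0)"] m X B by (simp add: scalar_prod_def atLeast0LessThan)
  then obtain q where "q < d" "B $$ (0, q) * X $$ (q, 0) \<noteq> 0"
    by (metis (no_types, lifting) lessThan_iff sum.neutral zero_neq_one)
  then show "0 < frob_norm X" "0 < frob_norm B"
    using m X B frob_norm_pos[of q X 0] frob_norm_pos[of 0 B q] by auto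
qed

lemma inverse_antimono_ennreal: "b \<le> c \<Longrightarrow> inverse c \<le> inverse (b :: ennreal)"
  including ennreal.lifting by transfer (rule ereal_inverse_antimono)

lemma divide_left_antimono_ennreal: "b \<le> c \<Longrightarrow> a / c \<le> a / (b :: ennreal)"
  unfolding divide_ennreal_def by (intro mult_left_mono inverse_antimono_ennreal) simp_all

theorem corollary7p4:
  fixes m :: nat and C :: tensor3
  assumes "m \<ge> 1"
    and "C \<in> carrier_tensor m"
    and "trivial_stabilizer m C"
  shows "non_identifiability m C \<le>
    ennreal (tensor_norm m C) /
    ennreal (Max {smallest_singular_value (flattening1 m C),
                  smallest_singular_value (flattening2 m C),
                  smallest_singular_value (flattening3 m C)})"
proof -
  define \<sigma> where "\<sigma> = Max {smallest_singular_value (flattening1 m C),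
    smallest_singular_value (flattening2 m C), smallest_singular_value (flattening3 m C)}"
  have gap: "\<sigma> \<le> tensor_norm m (\<lambda>i j k. C i j k - tensor_act C Z i j k)"
    if "Z \<in> carrier_mat m m" "det Z = 0" for Z
    using singular_value_flattening1_le[OF assms(1) that] singular_value_flattening2_le[OF assms(1) that]
      singular_value_flattening3_le[OF assms(1) that] by (simp add: \<sigma>_def)
  have C_pos: "0 < tensor_norm m C"
    using assms by (rule trivial_stabilizer_nonzero)
  have "non_identifiability m C \<le> ennreal (tensor_norm m C) / ennreal \<sigma>"
  proof (cases "0 < \<sigma>")
    \<comment> \<open>Then \<open>ennreal \<sigma>\<close> is 0, and with the positive numerator the
      right-hand side is infinite.\<close>
    case False
    then show ?thesis
      using C_pos by (simp add: ennreal_neg)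
  next
    case \<sigma>: True
    show ?thesis
    proof (rule non_identifiability_le)
      fix d and X :: "real mat" assume X: "X \<in> carrier_mat d m" "vec_space.rank d X = m"
      let ?B = "pseudo_inverse X"
      let ?x = "frob_norm X" and ?b = "frob_norm ?B" and ?c = "tensor_norm m C"
      have B: "?B \<in> carrier_mat m d" "?B * X = 1\<^sub>m m"
        using pseudo_inverse_full_column_rank[OF X] by auto
      have x: "0 < ?x" and b: "0 < ?b"
        using frob_norm_pos_of_left_inverse[OF assms(1) X(1) B] by auto
      \<comment> \<open>The bound is uniform in \<open>S\<close>, so it passes to the infimum, also
        when there are no ill-posed tensors.\<close>
      have "\<sigma> / ?b ^ 3 \<le> tensor_norm d (\<lambda>a b c. tensor_act C X a b c - S a b c)"
        if "S \<in> ill_posed m C d" for S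
        using ill_posed_distance[OF assms \<sigma> gap X(1) B that] b by (simp add: divide_le_eq)
      then have "ennreal (\<sigma> / ?b ^ 3) \<le>
          (INF S \<in> ill_posed m C d. ennreal (tensor_norm d (\<lambda>a b c. tensor_act C X a b c - S a b c)))"
        by (intro INF_greatest ennreal_leI)
      then have "non_identifiability_pair X C \<le> ennreal (?x ^ 3 * ?c) / ennreal (\<sigma> / ?b ^ 3)"
        using X unfolding non_identifiability_pair_def by (auto intro!: divide_left_antimono_ennreal)
      also have "\<dots> = ennreal (?x ^ 3 * ?c * ?b ^ 3 / \<sigma>)"
        using \<sigma> x b C_pos by (simp add: divide_ennreal)
      finally have "non_identifiability_pair X C / ennreal (cond_number X ^ 3) \<le>
          ennreal (?x ^ 3 * ?c * ?b ^ 3 / \<sigma>) / ennreal ((?x * ?b) ^ 3)"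
        unfolding cond_number_def by (rule divide_right_mono_ennreal)
      also have "\<dots> = ennreal (?x ^ 3 * ?c * ?b ^ 3 / \<sigma> / (?x * ?b) ^ 3)"
        using \<sigma> x b C_pos by (intro divide_ennreal) auto
      \<comment> \<open>Dividing by the cube of the condition number cancels exactly the factors
        |X|^3 and |B|^3.\<close>
      also have "?x ^ 3 * ?c * ?b ^ 3 / \<sigma> / (?x * ?b) ^ 3 = ?c / \<sigma>"
        using x b by (simp add: power_mult_distrib)
      also have "ennreal (?c / \<sigma>) = ennreal ?c / ennreal \<sigma>"
        using \<sigma> C_pos by (simp add: divide_ennreal)
      finally show "non_identifiability_pair X C / ennreal (cond_number X ^ 3) \<le> ennreal ?c / ennreal \<sigma>" .
    qed
  qed
  then show ?thesis
    by (simp only: \<sigma>_def)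
qed

end
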